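(* Fix $N$ and let $\mathcal V_N(\bm w)$ denote the velocity obtained by solving the linear saddle system with frozen midpoint $\bm w$ (see context). Let $$G_{k,n}(\bm w)=\bm m_h^n+\frac k2\mathcal V_N(\bm w).$$ Suppose a closed ball $D\subset V_N^3$ satisfies $\min_{\bm w\in D,\,j}|\bm w(\bm x_j)|\ge m_->0$, the lower-order field is continuously differentiable on $D$, and $G_{k,n}(D)\subset D$. Then $\mathcal V_N$ is Lipschitz on $D$: for some finite $L_{V,N}$, $$\|\mathcal V_N(\bm w)-\mathcal V_N(\bm z)\|_N\le L_{V,N}\|\bm w-\bm z\|_N,\qquad\bm w,\bm z\in D .$$ If $q_{\rm P}:=kL_{V,N}/2<1$, the Picard iteration $\widehat{\bm m}^{p+1}=G_{k,n}(\widehat{\bm m}^p)$ has a unique fixed point (denoted $\bm m_h^{n+1/2}$) in $D$ and $$\|\widehat{\bm m}^p-\bm m_h^{n+1/2}\|_N\le\frac{q_{\rm P}^p}{1-q_{\rm P}}\|\widehat{\bm m}^1-\widehat{\bm m}^0\|_N .$$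
   Context: Grid: a uniform periodic Cartesian grid with $N_g$ nodes $\bm x_j$ on $\Omega=\prod_{\ell=1}^d(0,L_\ell)$, $d\in\{2,3\}$; $V_N$ is the corresponding finite-dimensional space of trigonometric polynomials, identified with grid functions; $(u,v)_N=\frac{|\Omega|}{N_g}\sum_ju(\bm x_j)\cdot v(\bm x_j)$ with norm $\|\cdot\|_N$. Products are nodewise. $-\Delta_N$ multiplies the discrete Fourier coefficient at wave vector $\bm\xi$ by $|\bm\xi|^2$. Let $k>0$ be the time step, $\bm m_h^n\in V_N^3$ the magnetization at time $t_n=nk$, $t_{n+1/2}=t_n+k/2$, $\alpha>0$ and $\widehat C_{\rm exc}>0$ constants, and $\bm h_{\rm low}$ the (possibly nonlinear, time-dependent) lower-order field with values in $V_N^3$. For $\bm w\in V_N^3$ with nonzero nodal values, $\mathcal V_N(\bm w)=\bm v$, where $(\bm v,r)\in V_N^3\times V_N$ is the unique solution of: for all $(\bm\phi,q)\in V_N^3\times V_N$, $$\alpha(\bm v,\bm\phi)_N+(\bm w\times\bm v,\bm\phi)_N+\widehat C_{\rm exc}(-\Delta_N\bm m_h^n,\bm\phi)_N+\tfrac k2\widehat C_{\rm exc}(-\Delta_N\bm v,\bm\phi)_N+(\bm w\cdot\bm\phi,r)_N=(1+\alpha^2)(\bm h_{\rm low}(\bm w,t_{n+1/2}),\bm\phi)_N,$$ $$(\bm w\cdot\bm v,q)_N=0 .$$ The Picard iteration is used to solve the implicit midpoint step. In the scheme, its initial guess is $\widehat{\bm m}^0=\bm m_h^n+\frac k2\bm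 v_h^{n-1/2}$, where $\bm v_h^{n-1/2}$ is the midpoint velocity of the previous time step, with $\bm v_h^{-1/2}=0$ for the first step.
   Formalization: The error estimate is stated for any initial guess lying in D; the original does not say that the initial guess is in D, and without this the estimate can fail, since nothing is assumed about the lower-order field outside D. *)

theory Defs
  imports "HOL-Analysis.Analysis"
begin

text \<open>
  The grid has \<open>N $ l\<close> nodes in direction \<open>l\<close>; the finite type \<open>'g\<close> enumerates all the nodes through
  their multi-indices, so that \<open>CARD('g)\<close> is the total number of nodes.
  Trigonometric polynomials are identified with their nodal values: \<open>real ^ 'g\<close> is the space
  \<open>V\<^sub>N\<close> and \<open>real ^ 3 ^ 'g\<close> is its third power.
\<close>

definition periodic_grid :: "nat ^ 'd \<Rightarrow> real ^ 'd \<Rightarrow> ('g \<Rightarrow> nat ^ 'd) \<Rightarrow> bool" where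
  "periodic_grid N L node \<longleftrightarrow>
     (\<forall>l. 0 < L $ l) \<and> bij_betw node UNIV {j. \<forall>l. j $ l < N $ l}"

definition grid_point :: "nat ^ 'd \<Rightarrow> real ^ 'd \<Rightarrow> ('g \<Rightarrow> nat ^ 'd) \<Rightarrow> 'g \<Rightarrow> real ^ 'd" where
  "grid_point N L node j = (\<chi> l. real (node j $ l) * (L $ l / real (N $ l)))"

definition grid_inner :: "real ^ 'd \<Rightarrow> ('a::real_inner) ^ 'g \<Rightarrow> 'a ^ 'g \<Rightarrow> real" where
  "grid_inner L u v = (\<Prod>l\<in>UNIV. L $ l) / real CARD('g) * (\<Sum>j\<in>UNIV. u $ j \<bullet> v $ j)"

definition grid_norm :: "real ^ 'd \<Rightarrow> ('a::real_inner) ^ 'g \<Rightarrow> real" where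
  "grid_norm L u = sqrt (grid_inner L u u)"

definition grid_cball :: "real ^ 'd \<Rightarrow> ('a::real_inner) ^ 'g \<Rightarrow> real \<Rightarrow> ('a ^ 'g) set" where
  "grid_cball L c R = {w. grid_norm L (w - c) \<le> R}"

definition grid_dot :: "real ^ 3 ^ 'g \<Rightarrow> real ^ 3 ^ 'g \<Rightarrow> real ^ 'g" where
  "grid_dot u v = (\<chi> j. u $ j \<bullet> v $ j)"

definition grid_cross :: "real ^ 3 ^ 'g \<Rightarrow> real ^ 3 ^ 'g \<Rightarrow> real ^ 3 ^ 'g" where
  "grid_cross u v = (\<chi> j. cross3 (u $ j) (v $ j))"

text \<open>
  In each direction the mode numbers are those in \<open>[- N/2, N/2)\<close>; for even \<open>N\<close> the Nyquist mode
  is represented by \<open>- N/2\<close>.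
\<close>

definition grid_modes :: "nat ^ 'd \<Rightarrow> (int ^ 'd) set" where
  "grid_modes N = {\<kappa>. \<forall>l. - int (N $ l) \<le> 2 * \<kappa> $ l \<and> 2 * \<kappa> $ l < int (N $ l)}"

definition wave_vector :: "real ^ 'd \<Rightarrow> int ^ 'd \<Rightarrow> real ^ 'd" where
  "wave_vector L \<kappa> = (\<chi> l. 2 * pi * real_of_int (\<kappa> $ l) / L $ l)"

definition dft_coeff ::
  "nat ^ 'd \<Rightarrow> real ^ 'd \<Rightarrow> ('g \<Rightarrow> nat ^ 'd) \<Rightarrow> real ^ 'g \<Rightarrow> int ^ 'd \<Rightarrow> complex" where
  "dft_coeff N L node u \<kappa> =
     (\<Sum>j\<in>UNIV. of_real (u $ j) * cis (- (wave_vector L \<kappa> \<bullet> grid_point N L node j)))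
       / of_nat CARD('g)"

text \<open>
  The inverse transform below is real at every node, so taking the real part loses nothing;
  see \<open>inverse_dft_real\<close> and \<open>dft_neg_laplacian\<close>.
\<close>

definition neg_laplacian ::
  "nat ^ 'd \<Rightarrow> real ^ 'd \<Rightarrow> ('g \<Rightarrow> nat ^ 'd) \<Rightarrow> real ^ 'g \<Rightarrow> real ^ 'g" where
  "neg_laplacian N L node u =
     (\<chi> j. Re (\<Sum>\<kappa>\<in>grid_modes N.
        of_real ((norm (wave_vector L \<kappa>))\<^sup>2) * dft_coeff N L node u \<kappa>
          * cis (wave_vector L \<kappa> \<bullet> grid_point N L node j)))"

lemma grid_sizes_pos:
  fixes node :: "'g \<Rightarrow> nat ^ 'd"
  assumes "periodic_grid N L node"
  shows "0 < N $ l"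
proof -
  have "node undefined \<in> {j. \<forall>l. j $ l < N $ l}"
    using assms unfolding periodic_grid_def bij_betw_def by blast
  then show ?thesis by (metis gr0I mem_Collect_eq not_less0)
qed

lemma cis_phase:
  fixes node :: "'g \<Rightarrow> nat ^ 'd"
  assumes "periodic_grid N L node"
  shows "cis (wave_vector L \<kappa> \<bullet> grid_point N L node j) =
    (\<Prod>l\<in>UNIV. cis (2 * pi * real_of_int (\<kappa> $ l) * real (node j $ l) / real (N $ l)))"
proof -
  have L: "L $ l \<noteq> 0" for l
    using assms unfolding periodic_grid_def by (metis less_irrefl)
  have *: "cis (\<Sum>l\<in>A. f l) = (\<Prod>l\<in>A. cis (f l))" if "finite A" for A :: "'d set" and f
    using that by (induction A) (auto simp: cis_mult[symmetric])
  have "wave_vector L \<kappa> \<bullet> grid_point N L node j =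
    (\<Sum>l\<in>UNIV. 2 * pi * real_of_int (\<kappa> $ l) * real (node j $ l) / real (N $ l))"
    unfolding inner_vec_def wave_vector_def grid_point_def
    by (intro sum.cong) (auto simp: L)
  then show ?thesis using * by simp
qed

lemma geometric_cis_sum:
  assumes "0 < N" "a \<noteq> 0" "\<bar>a\<bar> < int N"
  shows "(\<Sum>i<N. cis (2 * pi * real_of_int a * real i / real N)) = 0"
proof -
  define z where "z = cis (2 * pi * real_of_int a / real N)"
  have zi: "cis (2 * pi * real_of_int a * real i / real N) = z ^ i" for i
    by (simp add: z_def Complex.DeMoivre mult_ac)
  have "z ^ N = cis (2 * pi * real_of_int a)"
    using assms(1) by (simp add: z_def Complex.DeMoivre)
  also have "\<dots> = 1" by (simp add: cis_multiple_2pi)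
  finally have zN: "z ^ N = 1" .
  have "z \<noteq> 1"
  proof
    assume "z = 1"
    then have "cos (2 * pi * real_of_int a / real N) = 1"
      unfolding z_def by (metis cis.simps(1) one_complex.simps(1))
    then obtain n :: int where "2 * pi * real_of_int a / real N = of_int n * 2 * pi"
      using cos_one_2pi_int by auto
    then have "real_of_int a = real_of_int n * real N"
      using assms(1) by (simp add: field_simps)
    then have an: "a = n * int N"
      by (metis of_int_eq_iff of_int_mult of_int_of_nat_eq)
    then have "n \<noteq> 0" using assms(2) by auto
    then have "int N \<le> \<bar>a\<bar>" using assms(1) by (simp add: an abs_mult)
    then show False using assms(3) by simp
  qed
  then show ?thesis by (simp add: zi geometric_sum zN)
qed

lemma sum_grid_prod:
  fixes node :: "'g::finite \<Rightarrow> nat ^ 'd" and f :: "'d \<Rightarrow> nat \<Rightarrow> complex"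
  assumes "periodic_grid N L node"
  shows "(\<Sum>j\<in>UNIV. \<Prod>l\<in>UNIV. f l (node j $ l)) = (\<Prod>l\<in>UNIV. \<Sum>i<N $ l. f l i)"
proof -
  have b: "bij_betw node UNIV {j. \<forall>l. j $ l < N $ l}"
    using assms unfolding periodic_grid_def by blast
  have "bij_betw vec_lambda (PiE UNIV (\<lambda>l. {..<N $ l})) {j. \<forall>l. j $ l < N $ l}"
    by (rule bij_betw_byWitness[where f' = vec_nth]) (auto simp: vec_lambda_inverse)
  then have "(\<Sum>J\<in>{j. \<forall>l. j $ l < N $ l}. \<Prod>l\<in>UNIV. f l (J $ l)) =
      (\<Sum>x\<in>PiE UNIV (\<lambda>l. {..<N $ l}). \<Prod>l\<in>UNIV. f l (x l))"
    by (subst sum.reindex_bij_betw[symmetric]) auto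
  also have "\<dots> = (\<Prod>l\<in>UNIV. \<Sum>i<N $ l. f l i)"
    by (subst prod_sum_PiE) auto
  finally show ?thesis
    using sum.reindex_bij_betw[OF b, of "\<lambda>J. \<Prod>l\<in>UNIV. f l (J $ l)"] by simp
qed

lemma grid_orthogonality:
  fixes node :: "'g::finite \<Rightarrow> nat ^ 'd"
  assumes g: "periodic_grid N L node" and "\<kappa> \<in> grid_modes N" "\<kappa>' \<in> grid_modes N"
  shows "(\<Sum>j\<in>UNIV. cis (wave_vector L \<kappa>' \<bullet> grid_point N L node j)
      * cis (- (wave_vector L \<kappa> \<bullet> grid_point N L node j))) =
    (if \<kappa>' = \<kappa> then of_nat CARD('g) else 0)"
proof (cases "\<kappa>' = \<kappa>")
  case True
  then show ?thesis by (simp add: cis_mult)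
next
  case False
  then obtain l where l: "\<kappa>' $ l \<noteq> \<kappa> $ l" by (auto simp: vec_eq_iff)
  have "wave_vector L \<kappa>' - wave_vector L \<kappa> = wave_vector L (\<kappa>' - \<kappa>)"
    by (simp add: wave_vector_def vec_eq_iff diff_divide_distrib right_diff_distrib)
  then have "cis (wave_vector L \<kappa>' \<bullet> grid_point N L node j)
      * cis (- (wave_vector L \<kappa> \<bullet> grid_point N L node j)) =
      (\<Prod>l\<in>UNIV. cis (2 * pi * real_of_int ((\<kappa>' - \<kappa>) $ l) * real (node j $ l) / real (N $ l)))" for j
    using cis_phase[OF g, of "\<kappa>' - \<kappa>" j] by (simp add: cis_mult inner_diff_left[symmetric])
  then have eq: "(\<Sum>j\<in>UNIV. cis (wave_vector L \<kappa>' \<bullet> grid_point N L node j)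
      * cis (- (wave_vector L \<kappa> \<bullet> grid_point N L node j))) =
      (\<Prod>l\<in>UNIV. \<Sum>i<N $ l. cis (2 * pi * real_of_int ((\<kappa>' - \<kappa>) $ l) * real i / real (N $ l)))"
    using sum_grid_prod[OF g, of
        "\<lambda>l i. cis (2 * pi * real_of_int ((\<kappa>' - \<kappa>) $ l) * real i / real (N $ l))"] by simp
  have "- int (N $ l) \<le> 2 * \<kappa> $ l" "2 * \<kappa> $ l < int (N $ l)"
    "- int (N $ l) \<le> 2 * \<kappa>' $ l" "2 * \<kappa>' $ l < int (N $ l)"
    using assms(2,3) unfolding grid_modes_def by auto
  then have "\<bar>(\<kappa>' - \<kappa>) $ l\<bar> < int (N $ l)" by simp
  then have "(\<Sum>i<N $ l. cis (2 * pi * real_of_int ((\<kappa>' - \<kappa>) $ l) * real i / real (N $ l))) = 0"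
    using l grid_sizes_pos[OF g] by (intro geometric_cis_sum) auto
  then show ?thesis using False eq by (metis (no_types, lifting) UNIV_I finite prod_zero)
qed

lemma finite_grid_modes: "finite (grid_modes N)"
proof -
  have "grid_modes N \<subseteq> vec_lambda ` PiE UNIV (\<lambda>l. {- int (N $ l)..int (N $ l)})"
  proof
    fix \<kappa> assume "\<kappa> \<in> grid_modes N"
    then have "\<forall>l. - int (N $ l) \<le> 2 * \<kappa> $ l \<and> 2 * \<kappa> $ l < int (N $ l)"
      by (simp add: grid_modes_def)
    then have "- int (N $ l) \<le> \<kappa> $ l \<and> \<kappa> $ l \<le> int (N $ l)" for l
      by (smt (verit))
    then have "vec_nth \<kappa> \<in> PiE UNIV (\<lambda>l. {- int (N $ l)..int (N $ l)})" by auto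
    then show "\<kappa> \<in> vec_lambda ` PiE UNIV (\<lambda>l. {- int (N $ l)..int (N $ l)})"
      by (metis image_eqI vec_nth_inverse)
  qed
  then show ?thesis by (rule finite_subset) (intro finite_imageI finite_PiE; simp)
qed

definition mode_reflect :: "nat ^ 'd \<Rightarrow> int ^ 'd \<Rightarrow> int ^ 'd" where
  "mode_reflect N \<kappa> = (\<chi> l. if 2 * \<kappa> $ l = - int (N $ l) then \<kappa> $ l else - \<kappa> $ l)"

lemma bij_mode_reflect:
  assumes "\<And>l. 0 < N $ l"
  shows "bij_betw (mode_reflect N) (grid_modes N) (grid_modes N)"
proof -
  have "mode_reflect N ` grid_modes N \<subseteq> grid_modes N"
  proof
    fix \<mu> assume "\<mu> \<in> mode_reflect N ` grid_modes N"
    then obtain \<kappa> where \<mu>: "\<mu> = mode_reflect N \<kappa>" and \<kappa>: "\<kappa> \<in> grid_modes N" by auto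
    have "- int (N $ l) \<le> 2 * \<mu> $ l \<and> 2 * \<mu> $ l < int (N $ l)" for l
    proof -
      have "- int (N $ l) \<le> 2 * \<kappa> $ l" "2 * \<kappa> $ l < int (N $ l)"
        using \<kappa> by (auto simp: grid_modes_def)
      then show ?thesis using assms[of l] by (simp add: \<mu> mode_reflect_def)
    qed
    then show "\<mu> \<in> grid_modes N" by (simp add: grid_modes_def)
  qed
  moreover have "mode_reflect N (mode_reflect N \<kappa>) = \<kappa>" if "\<kappa> \<in> grid_modes N" for \<kappa>
  proof -
    have "2 * \<kappa> $ l < int (N $ l)" for l using that by (simp add: grid_modes_def)
    then have "- (2 * \<kappa> $ l) \<noteq> - int (N $ l)" for l
      by (metis neg_equal_iff_equal less_irrefl)
    then show ?thesis by (simp add: mode_reflect_def vec_eq_iff)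
  qed
  ultimately show ?thesis
    by (intro bij_betw_byWitness[where f' = "mode_reflect N"]) auto
qed

lemma cis_mode_reflect:
  fixes node :: "'g \<Rightarrow> nat ^ 'd"
  assumes g: "periodic_grid N L node"
  shows "cis (wave_vector L (mode_reflect N \<kappa>) \<bullet> grid_point N L node j) =
    cnj (cis (wave_vector L \<kappa> \<bullet> grid_point N L node j))"
proof -
  have "cis (2 * pi * real_of_int (mode_reflect N \<kappa> $ l) * real (node j $ l) / real (N $ l)) =
    cnj (cis (2 * pi * real_of_int (\<kappa> $ l) * real (node j $ l) / real (N $ l)))" for l
  proof (cases "2 * \<kappa> $ l = - int (N $ l)")
    case True
    then have "2 * real_of_int (\<kappa> $ l) = - real (N $ l)"
      by (metis of_int_minus of_int_mult of_int_numeral of_int_of_nat_eq)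
    then have "2 * pi * real_of_int (\<kappa> $ l) * real (node j $ l) / real (N $ l) =
        - (pi * real (node j $ l))"
      using grid_sizes_pos[OF g, of l] by (simp add: field_simps)
    moreover have "cis (- (pi * real i)) = cis (pi * real i)" for i
      by (simp add: complex_eq_iff)
    ultimately show ?thesis
      using True by (simp add: mode_reflect_def cis_cnj)
  next
    case False
    then show ?thesis by (simp add: mode_reflect_def cis_cnj)
  qed
  then show ?thesis by (simp add: cis_phase[OF g])
qed

lemma inverse_dft_real:
  fixes node :: "'g::finite \<Rightarrow> nat ^ 'd"
  assumes g: "periodic_grid N L node"
  shows "(\<Sum>\<kappa>\<in>grid_modes N.
        of_real ((norm (wave_vector L \<kappa>))\<^sup>2) * dft_coeff N L node u \<kappa>
          * cis (wave_vector L \<kappa> \<bullet> grid_point N L node j)) = of_real (neg_laplacian N L node u $ j)"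
    (is "?S = _")
proof -
  let ?t = "\<lambda>\<kappa>. of_real ((norm (wave_vector L \<kappa>))\<^sup>2) * dft_coeff N L node u \<kappa>
          * cis (wave_vector L \<kappa> \<bullet> grid_point N L node j)"
  have nrm: "norm (wave_vector L (mode_reflect N \<kappa>)) = norm (wave_vector L \<kappa>)" for \<kappa>
    unfolding norm_vec_def
    by (rule arg_cong[where f = "\<lambda>x. L2_set x UNIV"]) (auto simp: wave_vector_def mode_reflect_def)
  have dft: "dft_coeff N L node u (mode_reflect N \<kappa>) = cnj (dft_coeff N L node u \<kappa>)" for \<kappa>
    by (simp add: dft_coeff_def cis_cnj[symmetric] cis_mode_reflect[OF g])
  have "?t (mode_reflect N \<kappa>) = cnj (?t \<kappa>)" for \<kappa>
    by (simp add: nrm dft cis_mode_reflect[OF g])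
  then have "cnj ?S = (\<Sum>\<kappa>\<in>grid_modes N. ?t (mode_reflect N \<kappa>))" by (simp add: cnj_sum)
  also have "\<dots> = ?S"
    using sum.reindex_bij_betw[OF bij_mode_reflect[OF grid_sizes_pos[OF g]], of ?t] by simp
  finally have "?S \<in> \<real>" using Reals_cnj_iff by blast
  then have "of_real (Re ?S) = ?S" by (rule of_real_Re)
  then show ?thesis unfolding neg_laplacian_def vec_lambda_beta by (rule sym)
qed

lemma dft_neg_laplacian:
  fixes node :: "'g::finite \<Rightarrow> nat ^ 'd"
  assumes g: "periodic_grid N L node" and \<kappa>: "\<kappa> \<in> grid_modes N"
  shows "dft_coeff N L node (neg_laplacian N L node u) \<kappa> =
    of_real ((norm (wave_vector L \<kappa>))\<^sup>2) * dft_coeff N L node u \<kappa>"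
proof -
  let ?c = "\<lambda>\<kappa>. of_real ((norm (wave_vector L \<kappa>))\<^sup>2) * dft_coeff N L node u \<kappa>"
  let ?e = "\<lambda>\<kappa> j. cis (wave_vector L \<kappa> \<bullet> grid_point N L node j)"
  let ?e' = "\<lambda>\<kappa> j. cis (- (wave_vector L \<kappa> \<bullet> grid_point N L node j))"
  have "(\<Sum>j\<in>UNIV. of_real (neg_laplacian N L node u $ j) * ?e' \<kappa> j) =
      (\<Sum>j\<in>UNIV. \<Sum>\<kappa>'\<in>grid_modes N. ?c \<kappa>' * (?e \<kappa>' j * ?e' \<kappa> j))"
    by (simp only: inverse_dft_real[OF g, symmetric] sum_distrib_right mult.assoc)
  also have "\<dots> = (\<Sum>\<kappa>'\<in>grid_modes N. ?c \<kappa>' * (\<Sum>j\<in>UNIV. ?e \<kappa>' j * ?e' \<kappa> j))"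
    by (subst sum.swap) (simp only: sum_distrib_left)
  also have "\<dots> = (\<Sum>\<kappa>'\<in>grid_modes N. if \<kappa>' = \<kappa> then ?c \<kappa> * of_nat CARD('g) else 0)"
    by (intro sum.cong refl) (simp add: grid_orthogonality[OF g \<kappa>])
  also have "\<dots> = ?c \<kappa> * of_nat CARD('g)"
    by (subst sum.delta[OF finite_grid_modes]) (simp only: \<kappa> if_True)
  finally show ?thesis by (simp add: dft_coeff_def)
qed

definition neg_laplacian_vec ::
  "nat ^ 'd \<Rightarrow> real ^ 'd \<Rightarrow> ('g \<Rightarrow> nat ^ 'd) \<Rightarrow> real ^ 3 ^ 'g \<Rightarrow> real ^ 3 ^ 'g" where
  "neg_laplacian_vec N L node u =
     (\<chi> j. \<chi> i. neg_laplacian N L node (\<chi> j'. u $ j' $ i) $ j)"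

definition saddle_solution ::
  "nat ^ 'd \<Rightarrow> real ^ 'd \<Rightarrow> ('g \<Rightarrow> nat ^ 'd) \<Rightarrow> real \<Rightarrow> real \<Rightarrow> real \<Rightarrow> real ^ 3 ^ 'g
    \<Rightarrow> (real ^ 3 ^ 'g \<Rightarrow> real \<Rightarrow> real ^ 3 ^ 'g) \<Rightarrow> real
    \<Rightarrow> real ^ 3 ^ 'g \<Rightarrow> (real ^ 3 ^ 'g) \<times> (real ^ 'g) \<Rightarrow> bool" where
  "saddle_solution N L node k \<alpha> Cexc m hlow t w = (\<lambda>(v, r). \<forall>\<phi> q.
      \<alpha> * grid_inner L v \<phi> + grid_inner L (grid_cross w v) \<phi>
        + Cexc * grid_inner L (neg_laplacian_vec N L node m) \<phi>
        + k / 2 * Cexc * grid_inner L (neg_laplacian_vec N L node v) \<phi>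
        + grid_inner L (grid_dot w \<phi>) r
      = (1 + \<alpha>\<^sup>2) * grid_inner L (hlow w t) \<phi>
      \<and> grid_inner L (grid_dot w v) q = 0)"

text \<open>Only meaningful if all nodal values of \<open>w\<close> are nonzero; otherwise \<open>r\<close> is not unique.\<close>

definition saddle_velocity ::
  "nat ^ 'd \<Rightarrow> real ^ 'd \<Rightarrow> ('g \<Rightarrow> nat ^ 'd) \<Rightarrow> real \<Rightarrow> real \<Rightarrow> real \<Rightarrow> real ^ 3 ^ 'g
    \<Rightarrow> (real ^ 3 ^ 'g \<Rightarrow> real \<Rightarrow> real ^ 3 ^ 'g) \<Rightarrow> real
    \<Rightarrow> real ^ 3 ^ 'g \<Rightarrow> real ^ 3 ^ 'g" where
  "saddle_velocity N L node k \<alpha> Cexc m hlow t w =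
     fst (THE vr. saddle_solution N L node k \<alpha> Cexc m hlow t w vr)"

text \<open>
  On a set that is not open (a closed ball, say) derivatives are taken relative to the set.
\<close>

definition C1_on :: "('a::real_normed_vector \<Rightarrow> 'b::real_normed_vector) \<Rightarrow> 'a set \<Rightarrow> bool" where
  "C1_on f S \<longleftrightarrow> (\<exists>f'. (\<forall>x\<in>S. (f has_derivative blinfun_apply (f' x)) (at x within S)) \<and>
     continuous_on S f')"

end

(*
  In strong form the saddle system reads T w (v, r) = b w, where T w = A + B w with A linear and
  B bilinear. Testing with v makes the cross product and the multiplier drop out, and the discrete
  Laplacian is positive semidefinite by Parseval, so T w is injective as soon as no nodal value of w
  vanishes. By compactness, norm (T w x) >= c * norm x with c > 0 independent of w in D. Hence
  x_w - x_z = (T w)^-1 (b w - b z - B (w - z) x_z) is Lipschitz in w, and the rest is the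
  contraction principle.
*)
theory Submission
  imports Defs
begin

section \<open>Linear systems depending on a parameter\<close>

text \<open>On the compact product of \<open>K\<close> with the unit sphere the norm of the image
  attains its minimum, which is positive because a zero there would contradict injectivity at a unit
  vector. Homogeneity in \<open>x\<close> extends the bound to all vectors, with one constant for
  all \<open>w\<close> in \<open>K\<close>.\<close>

lemma linear_plus_bilinear_bounded_below:
  fixes A :: "'b::euclidean_space \<Rightarrow> 'c::real_normed_vector"
    and B :: "'a::real_normed_vector \<Rightarrow> 'b \<Rightarrow> 'c"
  assumes A: "bounded_linear A" and B: "bounded_bilinear B" and K: "compact K"
    and inj: "\<And>w x. w \<in> K \<Longrightarrow> A x + B w x = 0 \<Longrightarrow> x = 0"
  obtains c where "0 < c" "\<And>w x. w \<in> K \<Longrightarrow> c * norm x \<le> norm (A x + B w x)"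
proof (cases "K = {}")
  case True
  then show ?thesis by (intro that[of 1]) auto
next
  case False
  interpret A: bounded_linear A by fact
  interpret B: bounded_bilinear B by fact
  let ?S = "K \<times> sphere (0::'b) 1"
  \<comment> \<open>A basis vector has norm 1, so the unit sphere is nonempty and the minimum is
    attained.\<close>
  obtain e :: 'b where "e \<in> Basis" using nonempty_Basis by blast
  then have "?S \<noteq> {}" using False by (auto intro!: exI[of _ e])
  moreover have "compact ?S" using K by (intro compact_Times) auto
  moreover have "continuous_on ?S (\<lambda>p. norm (A (snd p) + B (fst p) (snd p)))"
    by (intro continuous_intros A.continuous_on B.continuous_on)
  ultimately obtain p where p: "p \<in> ?S"
    and min: "\<And>q. q \<in> ?S \<Longrightarrow> norm (A (snd p) + B (fst p) (snd p)) \<le> norm (A (snd q) + B (fst q) (snd q))"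
    using continuous_attains_inf[of ?S "\<lambda>p. norm (A (snd p) + B (fst p) (snd p))"] by blast
  let ?c = "norm (A (snd p) + B (fst p) (snd p))"
  have "0 < ?c" using p inj[of "fst p" "snd p"] by (auto simp: mem_Times_iff)
  moreover have "?c * norm x \<le> norm (A x + B w x)" if w: "w \<in> K" for w x
  proof (cases "x = 0")
    case False
    have "?c \<le> norm (A (inverse (norm x) *\<^sub>R x) + B w (inverse (norm x) *\<^sub>R x))"
      using min[of "(w, inverse (norm x) *\<^sub>R x)"] w False by simp
    also have "\<dots> = norm (inverse (norm x) *\<^sub>R (A x + B w x))"
      by (simp add: A.scaleR B.scaleR_right scaleR_add_right)
    also have "\<dots> = norm (A x + B w x) / norm x"
      by (simp add: divide_inverse mult.commute)
    finally show ?thesis using False by (simp add: pos_le_divide_eq)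
  qed simp
  ultimately show ?thesis by (rule that)
qed

text \<open>The uniform lower bound is used twice: once to bound the solutions on \<open>K\<close>,
  and once to invert the operator at \<open>w\<close> in the equation for the difference of two
  solutions.\<close>

lemma lipschitz_solution_linear_plus_bilinear:
  fixes A :: "'b::euclidean_space \<Rightarrow> 'c::real_normed_vector"
    and B :: "'a::real_normed_vector \<Rightarrow> 'b \<Rightarrow> 'c"
  assumes A: "bounded_linear A" and B: "bounded_bilinear B" and K: "compact K"
    and inj: "\<And>w x. w \<in> K \<Longrightarrow> A x + B w x = 0 \<Longrightarrow> x = 0"
    and sol: "\<And>w. w \<in> K \<Longrightarrow> A (x w) + B w (x w) = b w"
    and b: "M-lipschitz_on K b"
  obtains M' where "M'-lipschitz_on K x"
proof -
  interpret A: bounded_linear A by fact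
  interpret B: bounded_bilinear B by fact
  obtain c where c: "0 < c" "\<And>w y. w \<in> K \<Longrightarrow> c * norm y \<le> norm (A y + B w y)"
    using linear_plus_bilinear_bounded_below[OF A B K] inj by metis
  have "compact (b ` K)"
    using K lipschitz_on_continuous_on[OF b] by (rule compact_continuous_image[rotated])
  then obtain Mb where Mb: "\<And>w. w \<in> K \<Longrightarrow> norm (b w) \<le> Mb"
    using compact_imp_bounded bounded_iff by (metis imageI)
  obtain C where C: "0 \<le> C" "\<And>u y. norm (B u y) \<le> norm u * norm y * C"
    using B.nonneg_bounded by blast
  have bnd: "norm (x w) \<le> Mb / c" if "w \<in> K" for w
    using c(2)[OF that, of "x w"] Mb[OF that] c(1) sol[OF that] by (simp add: field_simps)
  \<comment> \<open>\<open>Mb\<close> could be negative if \<open>K\<close> is empty; its absolute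
    value keeps the constant nonnegative, as \<open>lipschitz_on\<close> demands.\<close>
  have "norm (x w - x z) \<le> (M + \<bar>Mb\<bar> / c * C) / c * norm (w - z)" if w: "w \<in> K" and z: "z \<in> K" for w z
  proof -
    \<comment> \<open>Bilinearity lets the change of the operator act on the known solution
      \<open>x z\<close>, so it becomes part of the right-hand side.\<close>
    have "A (x w - x z) + B w (x w - x z) = b w - b z - B (w - z) (x z)"
      using sol[OF w] sol[OF z] by (simp add: A.diff B.diff_right B.diff_left algebra_simps)
    then have "c * norm (x w - x z) \<le> norm (b w - b z) + norm (B (w - z) (x z))"
      using c(2)[OF w, of "x w - x z"] by (metis norm_triangle_ineq4 order_trans)
    also have "\<dots> \<le> M * norm (w - z) + norm (w - z) * (\<bar>Mb\<bar> / c) * C"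
    proof (rule add_mono)
      show "norm (b w - b z) \<le> M * norm (w - z)"
        using lipschitz_onD[OF b w z] by (simp add: dist_norm)
      have "Mb / c \<le> \<bar>Mb\<bar> / c" using c(1) by (simp add: divide_right_mono)
      then have "norm (x z) \<le> \<bar>Mb\<bar> / c" using bnd[OF z] by linarith
      then have "norm (w - z) * norm (x z) * C \<le> norm (w - z) * (\<bar>Mb\<bar> / c) * C"
        using C(1) by (intro mult_right_mono mult_left_mono) auto
      then show "norm (B (w - z) (x z)) \<le> norm (w - z) * (\<bar>Mb\<bar> / c) * C"
        using C(2)[of "w - z" "x z"] by linarith
    qed
    finally show ?thesis using c(1) by (simp add: field_simps)
  qed
  moreover have "0 \<le> (M + \<bar>Mb\<bar> / c * C) / c"
    using c(1) C(1) lipschitz_on_nonneg[OF b] by simp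
  ultimately have "((M + \<bar>Mb\<bar> / c * C) / c)-lipschitz_on K x"
    unfolding lipschitz_on_def dist_norm by blast
  then show ?thesis by (rule that)
qed

text \<open>The derivative is continuous on a compact set, hence bounded; convexity keeps segments
  inside \<open>S\<close>, so the mean value inequality applies.\<close>

lemma C1_on_compact_convex_lipschitz:
  assumes "C1_on f S" "compact S" "convex S"
  obtains M where "M-lipschitz_on S f"
proof -
  obtain f' where f': "\<And>x. x \<in> S \<Longrightarrow> (f has_derivative blinfun_apply (f' x)) (at x within S)"
    and cont: "continuous_on S f'"
    using assms(1) unfolding C1_on_def by blast
  have "bounded (f' ` S)"
    using cont assms(2) by (intro compact_imp_bounded compact_continuous_image)
  then obtain M where M: "0 < M" "\<And>x. x \<in> S \<Longrightarrow> norm (f' x) \<le> M"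
    by (auto simp: bounded_pos)
  have "norm (f x - f y) \<le> M * norm (x - y)" if "x \<in> S" "y \<in> S" for x y
    using assms(3) f' M(2) that
    by (intro differentiable_bound[of S f "\<lambda>x. blinfun_apply (f' x)"]) (auto simp: norm_blinfun.rep_eq)
  then have "M-lipschitz_on S f"
    using M(1) by (auto simp: lipschitz_on_def dist_norm)
  then show ?thesis by (rule that)
qed

section \<open>Linearity and positivity of the discrete Laplacian\<close>

lemma linear_dft_coeff: "linear (\<lambda>u. dft_coeff N L node u \<kappa>)"
  by (rule linearI)
    (simp_all add: dft_coeff_def sum.distrib add_divide_distrib distrib_right
      scaleR_conv_of_real[where 'a = complex]
      sum_distrib_left mult.assoc)

lemma linear_neg_laplacian: "linear (neg_laplacian N L node)"
proof (rule linearI)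
  fix u v :: "real ^ 'a" and a :: real
  show "neg_laplacian N L node (u + v) = neg_laplacian N L node u + neg_laplacian N L node v"
    by (simp only: neg_laplacian_def vec_eq_iff linear_add[OF linear_dft_coeff] distrib_left
        distrib_right sum.distrib vec_lambda_beta vector_add_component plus_complex.sel)
      simp
  show "neg_laplacian N L node (a *\<^sub>R u) = a *\<^sub>R neg_laplacian N L node u"
    by (simp only: neg_laplacian_def vec_eq_iff linear_scale[OF linear_dft_coeff]
        mult_scaleR_right mult_scaleR_left scaleR_sum_right[symmetric] vec_lambda_beta
        vector_scaleR_component scaleR_complex.sel) simp
qed

text \<open>In Fourier coefficients the quadratic form becomes a sum of squared moduli with the
  nonnegative weights \<open>?a \<kappa>\<close>, times the number of nodes.\<close>

lemma neg_laplacian_nonneg: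
  fixes node :: "'g::finite \<Rightarrow> nat ^ 'd"
  shows "0 \<le> u \<bullet> neg_laplacian N L node u"
proof -
  let ?a = "\<lambda>\<kappa>. (norm (wave_vector L \<kappa>))\<^sup>2" and ?c = "dft_coeff N L node u"
  let ?e = "\<lambda>\<kappa> j. cis (wave_vector L \<kappa> \<bullet> grid_point N L node j)"
  \<comment> \<open>As \<open>u\<close> is real, reversing the sign of the phase conjugates the
    coefficient; the factor \<open>CARD('g)\<close> undoes the normalisation in
    \<open>dft_coeff\<close>.\<close>
  have conj: "(\<Sum>j\<in>UNIV. of_real (u $ j) * ?e \<kappa> j) = of_nat CARD('g) * cnj (?c \<kappa>)" for \<kappa>
    by (simp add: dft_coeff_def cis_cnj)
  have "u \<bullet> neg_laplacian N L node u =
      Re (\<Sum>j\<in>UNIV. \<Sum>\<kappa>\<in>grid_modes N. of_real (?a \<kappa>) * ?c \<kappa> * (of_real (u $ j) * ?e \<kappa> j))"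
    unfolding inner_vec_def neg_laplacian_def Re_sum
    by (intro sum.cong refl) (simp add: sum_distrib_left algebra_simps)
  also have "\<dots> = Re (\<Sum>\<kappa>\<in>grid_modes N. of_real (?a \<kappa>) * ?c \<kappa> * (of_nat CARD('g) * cnj (?c \<kappa>)))"
    by (subst sum.swap) (simp only: sum_distrib_left[symmetric] conj)
  also have "\<dots> = (\<Sum>\<kappa>\<in>grid_modes N. ?a \<kappa> * real CARD('g) * (cmod (?c \<kappa>))\<^sup>2)"
    unfolding Re_sum
  proof (intro sum.cong refl)
    fix \<kappa>
    have "of_real (?a \<kappa>) * ?c \<kappa> * (of_nat CARD('g) * cnj (?c \<kappa>)) =
        of_real (?a \<kappa> * real CARD('g)) * (?c \<kappa> * cnj (?c \<kappa>))" by simp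
    also have "\<dots> = of_real (?a \<kappa> * real CARD('g) * (cmod (?c \<kappa>))\<^sup>2)"
      by (simp add: complex_norm_square del: of_real_power)
    finally show "Re (of_real (?a \<kappa>) * ?c \<kappa> * (of_nat CARD('g) * cnj (?c \<kappa>))) =
        ?a \<kappa> * real CARD('g) * (cmod (?c \<kappa>))\<^sup>2" by (metis Re_complex_of_real)
  qed
  also have "\<dots> \<ge> 0" by (intro sum_nonneg) simp
  finally show ?thesis .
qed

lemma linear_neg_laplacian_vec:
  fixes node :: "'g::finite \<Rightarrow> nat ^ 'd"
  shows "linear (neg_laplacian_vec N L node)"
proof (rule linearI)
  fix u v :: "real ^ 3 ^ 'g" and a :: real
  have "(\<chi> j. (u + v) $ j $ i) = (\<chi> j. u $ j $ i) + (\<chi> j. v $ j $ i)"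
    "(\<chi> j. (a *\<^sub>R u) $ j $ i) = a *\<^sub>R (\<chi> j. u $ j $ i)" for i
    by (simp_all add: vec_eq_iff)
  then show "neg_laplacian_vec N L node (u + v) =
      neg_laplacian_vec N L node u + neg_laplacian_vec N L node v"
    "neg_laplacian_vec N L node (a *\<^sub>R u) = a *\<^sub>R neg_laplacian_vec N L node u"
    by (simp_all only: neg_laplacian_vec_def linear_add[OF linear_neg_laplacian]
        linear_scale[OF linear_neg_laplacian]) (simp_all add: vec_eq_iff)
qed

text \<open>The operator acts on each component separately, so exchanging the sums over nodes and
  components reduces this to the scalar case.\<close>

lemma neg_laplacian_vec_nonneg: "0 \<le> u \<bullet> neg_laplacian_vec N L node u"
proof -
  have "u \<bullet> neg_laplacian_vec N L node u =
      (\<Sum>i\<in>UNIV. (\<chi> j. u $ j $ i) \<bullet> neg_laplacian N L node (\<chi> j. u $ j $ i))"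
    by (simp add: inner_vec_def neg_laplacian_vec_def) (rule sum.swap)
  then show ?thesis by (simp add: sum_nonneg neg_laplacian_nonneg)
qed

section \<open>The saddle system as an operator equation\<close>

lemma grid_inner_eq:
  fixes u v :: "('a::real_inner) ^ 'g"
  shows "grid_inner L u v = (\<Prod>l\<in>UNIV. L $ l) / real CARD('g) * (u \<bullet> v)"
  by (simp add: grid_inner_def inner_vec_def)

lemma grid_norm_eq:
  fixes u :: "('a::real_inner) ^ 'g"
  shows "grid_norm L u = sqrt ((\<Prod>l\<in>UNIV. L $ l) / real CARD('g)) * norm u"
  by (simp only: grid_norm_def grid_inner_eq real_sqrt_mult norm_eq_sqrt_inner)

lemma grid_weight_pos:
  fixes node :: "'g::finite \<Rightarrow> nat ^ 'd"
  assumes "periodic_grid N L node"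
  shows "0 < (\<Prod>l\<in>UNIV. L $ l) / real CARD('g)"
  using assms by (auto simp: periodic_grid_def intro!: divide_pos_pos prod_pos)

text \<open>This is the adjoint of \<open>grid_dot w\<close>; it rewrites the multiplier term of the
  weak system as a vector paired with the test function.\<close>

lemma grid_dot_inner: "grid_dot w \<phi> \<bullet> r = (\<chi> j. r $ j *\<^sub>R w $ j) \<bullet> \<phi>"
  by (simp add: grid_dot_def inner_vec_def[where 'b = 'a] inner_vec_def[of "\<chi> j. r $ j *\<^sub>R w $ j"] mult.commute)

text \<open>The part of the saddle operator that is independent of \<open>w\<close>, used with
  \<open>\<beta>\<close> equal to \<open>k / 2 * Cexc\<close>. Its constraint row is zero because
  the constraint depends linearly on \<open>w\<close>.\<close>

definition saddle_const ::
  "nat ^ 'd \<Rightarrow> real ^ 'd \<Rightarrow> ('g \<Rightarrow> nat ^ 'd) \<Rightarrow> real \<Rightarrow> real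
    \<Rightarrow> (real ^ 3 ^ 'g) \<times> (real ^ 'g) \<Rightarrow> (real ^ 3 ^ 'g) \<times> (real ^ 'g)" where
  "saddle_const N L node \<alpha> \<beta> = (\<lambda>(v, r).
     (\<alpha> *\<^sub>R v + \<beta> *\<^sub>R neg_laplacian_vec N L node v, 0))"

definition saddle_coupling ::
  "real ^ 3 ^ 'g \<Rightarrow> (real ^ 3 ^ 'g) \<times> (real ^ 'g) \<Rightarrow> (real ^ 3 ^ 'g) \<times> (real ^ 'g)" where
  "saddle_coupling w = (\<lambda>(v, r). (grid_cross w v + (\<chi> j. r $ j *\<^sub>R w $ j), grid_dot w v))"

lemma linear_saddle_const: "linear (saddle_const N L node \<alpha> \<beta>)"
  by (rule linearI) (auto simp: saddle_const_def linear_add[OF linear_neg_laplacian_vec]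
      linear_scale[OF linear_neg_laplacian_vec] algebra_simps)

lemma bounded_bilinear_saddle_coupling: "bounded_bilinear saddle_coupling"
  unfolding bilinear_conv_bounded_bilinear[symmetric] bilinear_def
  by (auto intro!: linearI simp: saddle_coupling_def grid_cross_def grid_dot_def vec_eq_iff
      cross3_simps inner_add_left inner_add_right)

text \<open>Testing the momentum row with \<open>v\<close> leaves an energy identity of two
  nonnegative terms, so \<open>v\<close> vanishes. What remains of that row is the product of
  \<open>r\<close> and \<open>w\<close>, and the nonzero nodal values of \<open>w\<close> force
  \<open>r\<close> to vanish as well.\<close>

lemma saddle_operator_injective:
  fixes w :: "real ^ 3 ^ 'g"
  assumes "0 < \<alpha>" "0 \<le> \<beta>" and w: "\<And>j. w $ j \<noteq> 0"
    and eq: "saddle_const N L node \<alpha> \<beta> x + saddle_coupling w x = 0"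
  shows "x = 0"
proof -
  obtain v r where x: "x = (v, r)" by (cases x)
  let ?A = "neg_laplacian_vec N L node v" and ?rw = "\<chi> j. r $ j *\<^sub>R w $ j"
  have mom: "\<alpha> *\<^sub>R v + \<beta> *\<^sub>R ?A + (grid_cross w v + ?rw) = 0" and dot: "grid_dot w v = 0"
    using eq by (auto simp: x saddle_const_def saddle_coupling_def zero_prod_def)
  have "grid_cross w v \<bullet> v = 0"
    by (simp only: inner_vec_def[of "grid_cross w v"]) (simp add: grid_cross_def dot_cross_self)
  moreover have "?rw \<bullet> v = 0"
    using dot by (simp flip: grid_dot_inner)
  ultimately have "\<alpha> * (v \<bullet> v) + \<beta> * (v \<bullet> ?A) = 0"
    using arg_cong[OF mom, of "\<lambda>y. y \<bullet> v"] by (simp add: inner_add_right inner_commute)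
  moreover have "0 \<le> \<beta> * (v \<bullet> ?A)" using assms(2) neg_laplacian_vec_nonneg by (rule mult_nonneg_nonneg)
  moreover have "0 \<le> \<alpha> * (v \<bullet> v)" using assms(1) by simp
  ultimately have "\<alpha> * (v \<bullet> v) = 0" by linarith
  then have v: "v = 0" using assms(1) by simp
  have "?A = 0" unfolding v by (rule linear_0[OF linear_neg_laplacian_vec])
  then have "grid_cross w v + ?rw = 0" using mom v by simp
  moreover have "grid_cross w v = 0" by (simp add: v grid_cross_def vec_eq_iff)
  ultimately have "r $ j *\<^sub>R w $ j = 0" for j by (simp add: vec_eq_iff)
  then have "r = 0" using w by (metis scaleR_eq_0_iff vec_eq_iff zero_index)
  then show ?thesis by (simp add: x v zero_prod_def)
qed

lemma inner_all_zero_iff: "(\<forall>y. x \<bullet> y = 0) \<longleftrightarrow> x = (0::'a::real_inner)"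
  by (metis inner_eq_zero_iff inner_zero_left)

text \<open>Validity for all test functions means that the residual is orthogonal to everything,
  hence zero; the positive quadrature weight cancels.\<close>

lemma saddle_solution_iff:
  fixes node :: "'g::finite \<Rightarrow> nat ^ 'd"
  assumes "periodic_grid N L node"
  shows "saddle_solution N L node k \<alpha> Cexc m hlow t w x \<longleftrightarrow>
    saddle_const N L node \<alpha> (k / 2 * Cexc) x + saddle_coupling w x =
      ((1 + \<alpha>\<^sup>2) *\<^sub>R hlow w t - Cexc *\<^sub>R neg_laplacian_vec N L node m, 0)"
proof -
  obtain v r where x: "x = (v, r)" by (cases x)
  let ?\<omega> = "(\<Prod>l\<in>UNIV. L $ l) / real CARD('g)"
  let ?lhs = "\<alpha> *\<^sub>R v + (k / 2 * Cexc) *\<^sub>R neg_laplacian_vec N L node v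
    + (grid_cross w v + (\<chi> j. r $ j *\<^sub>R w $ j))"
  let ?rhs = "(1 + \<alpha>\<^sup>2) *\<^sub>R hlow w t - Cexc *\<^sub>R neg_laplacian_vec N L node m"
  have pos: "0 < ?\<omega>" using grid_weight_pos[OF assms] .
  have "\<alpha> * grid_inner L v \<phi> + grid_inner L (grid_cross w v) \<phi>
        + Cexc * grid_inner L (neg_laplacian_vec N L node m) \<phi>
        + k / 2 * Cexc * grid_inner L (neg_laplacian_vec N L node v) \<phi>
        + grid_inner L (grid_dot w \<phi>) r
      - (1 + \<alpha>\<^sup>2) * grid_inner L (hlow w t) \<phi> = ?\<omega> * ((?lhs - ?rhs) \<bullet> \<phi>)" for \<phi>
    unfolding grid_inner_eq grid_dot_inner inner_add_left inner_diff_left inner_scaleR_left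
    by algebra
  note eq = this
  have 1: "\<alpha> * grid_inner L v \<phi> + grid_inner L (grid_cross w v) \<phi>
        + Cexc * grid_inner L (neg_laplacian_vec N L node m) \<phi>
        + k / 2 * Cexc * grid_inner L (neg_laplacian_vec N L node v) \<phi>
        + grid_inner L (grid_dot w \<phi>) r
      = (1 + \<alpha>\<^sup>2) * grid_inner L (hlow w t) \<phi> \<longleftrightarrow> (?lhs - ?rhs) \<bullet> \<phi> = 0" for \<phi>
    using pos by (subst eq_iff_diff_eq_0, subst eq) (auto simp only: mult_eq_0_iff)
  have 2: "grid_inner L (grid_dot w v) q = 0 \<longleftrightarrow> grid_dot w v \<bullet> q = 0" for q
    using pos unfolding grid_inner_eq by (metis mult_eq_0_iff less_irrefl)
  have "saddle_solution N L node k \<alpha> Cexc m hlow t w x \<longleftrightarrow>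
      (\<forall>\<phi>. (?lhs - ?rhs) \<bullet> \<phi> = 0) \<and> (\<forall>q. grid_dot w v \<bullet> q = 0)"
    unfolding saddle_solution_def x prod.case 1 2 by blast
  also have "\<dots> \<longleftrightarrow> ?lhs = ?rhs \<and> grid_dot w v = 0"
    by (simp only: inner_all_zero_iff right_minus_eq)
  finally show ?thesis by (simp add: x saddle_const_def saddle_coupling_def)
qed

text \<open>An injective linear endomorphism in finite dimension is bijective. This ensures that the
  definite description in \<open>saddle_velocity\<close> denotes the actual solution.\<close>

lemma saddle_solution_ex1:
  fixes node :: "'g::finite \<Rightarrow> nat ^ 'd"
  assumes g: "periodic_grid N L node" and pos: "0 < k" "0 < \<alpha>" "0 < Cexc"
    and w: "\<And>j. w $ j \<noteq> 0"
  shows "\<exists>!x. saddle_solution N L node k \<alpha> Cexc m hlow t w x"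
proof -
  let ?T = "\<lambda>x. saddle_const N L node \<alpha> (k / 2 * Cexc) x + saddle_coupling w x"
  have lin: "linear ?T"
    using bounded_bilinear.bounded_linear_right[OF bounded_bilinear_saddle_coupling]
    by (intro linear_compose_add linear_saddle_const bounded_linear.linear)
  have "x = 0" if "?T x = 0" for x
    using saddle_operator_injective[OF _ _ w that] pos by simp
  then have inj: "inj ?T" using linear_injective_0[OF lin] by blast
  then have "surj ?T" by (rule linear_inj_imp_surj[OF lin])
  then show ?thesis
    unfolding saddle_solution_iff[OF g] using inj by (intro bij_iff[THEN iffD1, rule_format] bijI)
qed

section \<open>Lipschitz velocity and the contraction\<close>

lemma saddle_velocity_lipschitz:
  fixes node :: "'g::finite \<Rightarrow> nat ^ 'd"
  assumes g: "periodic_grid N L node" and pos: "0 < k" "0 < \<alpha>" "0 < Cexc"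
    and D: "compact D" "convex D" and w: "\<And>w j. w \<in> D \<Longrightarrow> w $ j \<noteq> 0"
    and h: "C1_on (\<lambda>w. hlow w t) D"
  obtains M where "M-lipschitz_on D (saddle_velocity N L node k \<alpha> Cexc m hlow t)"
proof -
  let ?b = "\<lambda>w. ((1 + \<alpha>\<^sup>2) *\<^sub>R hlow w t - Cexc *\<^sub>R neg_laplacian_vec N L node m, 0)"
  let ?x = "\<lambda>w. THE x. saddle_solution N L node k \<alpha> Cexc m hlow t w x"
  obtain Mh where Mh: "Mh-lipschitz_on D (\<lambda>w. hlow w t)"
    using C1_on_compact_convex_lipschitz[OF h D] .
  \<comment> \<open>Only the lower-order field depends on \<open>w\<close>; the exchange term of
    \<open>m\<close> cancels in differences.\<close>
  have "((1 + \<alpha>\<^sup>2) * Mh)-lipschitz_on D ?b"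
    using Mh by (auto simp: lipschitz_on_def dist_Pair_Pair dist_norm mult.assoc
        simp flip: scaleR_diff_right intro!: mult_left_mono)
  moreover have sol: "saddle_const N L node \<alpha> (k / 2 * Cexc) (?x z) + saddle_coupling z (?x z) = ?b z"
    if "z \<in> D" for z
    using theI'[OF saddle_solution_ex1[OF g pos w[OF that]]] by (simp only: saddle_solution_iff[OF g])
  moreover have inj: "x = 0"
    if "z \<in> D" "saddle_const N L node \<alpha> (k / 2 * Cexc) x + saddle_coupling z x = 0" for z x
    using saddle_operator_injective[OF _ _ w[OF that(1)] that(2)] pos by simp
  ultimately obtain M where M: "M-lipschitz_on D ?x"
    using lipschitz_solution_linear_plus_bilinear[where x = ?x and b = ?b,
        OF linear_conv_bounded_linear[THEN iffD1, OF linear_saddle_const]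
          bounded_bilinear_saddle_coupling D(1)] by blast
  \<comment> \<open>Projecting the pair to the velocity does not increase distances.\<close>
  have "M-lipschitz_on D (\<lambda>w. fst (?x w))"
    using M order_trans[OF dist_fst_le] unfolding lipschitz_on_def by blast
  then show ?thesis using that by (simp add: saddle_velocity_def[abs_def])
qed

text \<open>Each step shrinks the distance to the fixed point by \<open>q\<close>; the unknown
  initial distance is then bounded by the length of the first step.\<close>

lemma contraction_iteration_error:
  fixes f :: "'a::metric_space \<Rightarrow> 'a"
  assumes lip: "q-lipschitz_on D f" and q: "q < 1" and self: "f ` D \<subseteq> D"
    and x: "x \<in> D" "f x = x" and y: "y 0 \<in> D" "\<And>p. y (Suc p) = f (y p)"
  shows "dist (y p) x \<le> q ^ p / (1 - q) * dist (y 1) (y 0)"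
proof -
  have yD: "y p \<in> D" for p
    by (induction p) (use y self in auto)
  have step: "dist (y (Suc p)) x \<le> q * dist (y p) x" for p
    using lipschitz_onD[OF lip yD[of p] x(1)] x(2) y(2) by simp
  have q0: "0 \<le> q" using lipschitz_on_nonneg[OF lip] .
  have "dist (y p) x \<le> q ^ p * dist (y 0) x"
  proof (induction p)
    case (Suc p)
    then show ?case
      using step[of p] mult_left_mono[OF Suc.IH q0] by (simp add: mult.assoc)
  qed simp
  \<comment> \<open>The triangle inequality through \<open>y 1\<close> bounds this distance by the
    first step plus \<open>q\<close> times itself; the latter is absorbed because
    \<open>q < 1\<close>.\<close>
  moreover have "dist (y 0) x \<le> dist (y 1) (y 0) / (1 - q)"
    using step[of 0] dist_triangle[of "y 0" x "y 1"] q
    by (simp add: field_simps dist_commute)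
  then have "q ^ p * dist (y 0) x \<le> q ^ p * (dist (y 1) (y 0) / (1 - q))"
    using q0 by (intro mult_left_mono) auto
  ultimately show ?thesis by simp
qed

text \<open>The second half allows every nonnegative Lipschitz constant \<open>LV\<close> of
  \<open>V\<close> on \<open>D\<close>, and the iteration may start anywhere in \<open>D\<close>;
  the initial guess of the scheme is covered when it lies in \<open>D\<close>.\<close>

theorem proposition2:
  fixes N :: "nat ^ 'd" and L :: "real ^ 'd" and node :: "'g::finite \<Rightarrow> nat ^ 'd"
    and k \<alpha> Cexc :: real and n :: nat
    and m :: "real ^ 3 ^ 'g"
    and hlow :: "real ^ 3 ^ 'g \<Rightarrow> real \<Rightarrow> real ^ 3 ^ 'g"
    and V G :: "real ^ 3 ^ 'g \<Rightarrow> real ^ 3 ^ 'g"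
    and D :: "(real ^ 3 ^ 'g) set" and c :: "real ^ 3 ^ 'g" and R m_low :: real
  assumes dim: "CARD('d) \<in> {2, 3}"
    and grid: "periodic_grid N L node"
    and k_pos: "0 < k" and \<alpha>_pos: "0 < \<alpha>" and Cexc_pos: "0 < Cexc"
    and V_eq: "V = saddle_velocity N L node k \<alpha> Cexc m hlow (real n * k + k / 2)"
    and G_eq: "G = (\<lambda>w. m + (k / 2) *\<^sub>R V w)"
    and R_nonneg: "0 \<le> R" and D_eq: "D = grid_cball L c R"
    and m_low_pos: "0 < m_low" and nodal_bound: "\<And>w j. w \<in> D \<Longrightarrow> m_low \<le> norm (w $ j)"
    and hlow_C1: "C1_on (\<lambda>w. hlow w (real n * k + k / 2)) D"
    and G_self: "G ` D \<subseteq> D"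
  shows "(\<exists>LV\<ge>0. \<forall>w\<in>D. \<forall>z\<in>D. grid_norm L (V w - V z) \<le> LV * grid_norm L (w - z)) \<and>
    (\<forall>LV\<ge>0. \<forall>qP.
       (\<forall>w\<in>D. \<forall>z\<in>D. grid_norm L (V w - V z) \<le> LV * grid_norm L (w - z)) \<longrightarrow>
       qP = k * LV / 2 \<longrightarrow> qP < 1 \<longrightarrow>
       (\<exists>!m_mid. m_mid \<in> D \<and> G m_mid = m_mid) \<and>
       (\<forall>m_mid mhat. m_mid \<in> D \<and> G m_mid = m_mid \<and>
          mhat 0 \<in> D \<and> (\<forall>p. mhat (Suc p) = G (mhat p)) \<longrightarrow>
          (\<forall>p. grid_norm L (mhat p - m_mid) \<le>
            qP ^ p / (1 - qP) * grid_norm L (mhat 1 - mhat 0))))"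
proof -
  define s where "s = sqrt ((\<Prod>l\<in>UNIV. L $ l) / real CARD('g))"
  have s: "0 < s" using grid_weight_pos[OF grid] by (simp add: s_def)
  have norm_eq: "grid_norm L u = s * norm u" for u :: "real ^ 3 ^ 'g"
    by (simp add: grid_norm_eq s_def)
  \<comment> \<open>The grid norm is \<open>s\<close> times the Euclidean norm, so the grid ball is
    a Euclidean ball, which yields compactness and convexity.\<close>
  have "D = cball c (R / s)"
    using s by (auto simp: D_eq grid_cball_def norm_eq dist_norm norm_minus_commute field_simps)
  then have D: "compact D" "convex D" "D \<noteq> {}"
    using divide_nonneg_pos[OF R_nonneg s] by auto
  \<comment> \<open>The factor \<open>s\<close> cancels, so both norms have the same Lipschitz
    constants.\<close>
  have lip_iff: "(\<forall>w\<in>D. \<forall>z\<in>D. grid_norm L (V w - V z) \<le> M * grid_norm L (w - z)) \<longleftrightarrow>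
      M-lipschitz_on D V" if "0 \<le> M" for M
    using s that by (auto simp: lipschitz_on_def norm_eq dist_norm mult.left_commute)
  have nz: "w $ j \<noteq> 0" if "w \<in> D" for w j
    using nodal_bound[OF that, of j] m_low_pos by auto
  obtain M where "M-lipschitz_on D V"
    unfolding V_eq
    by (rule saddle_velocity_lipschitz[OF grid k_pos \<alpha>_pos Cexc_pos D(1,2) nz,
          where hlow = hlow and t = "real n * k + k / 2" and m = m]) (use hlow_C1 in auto)
  then have ex: "\<exists>LV\<ge>0. \<forall>w\<in>D. \<forall>z\<in>D. grid_norm L (V w - V z) \<le> LV * grid_norm L (w - z)"
    using lip_iff lipschitz_on_nonneg by blast
  have lip_G: "(k * LV / 2)-lipschitz_on D G" if V: "LV-lipschitz_on D V" for LV
  proof -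
    have "norm (G w - G z) = k / 2 * norm (V w - V z)" for w z
      using k_pos by (simp add: G_eq flip: scaleR_diff_right)
    then show ?thesis
      using V k_pos by (auto simp: lipschitz_on_def dist_norm)
  qed
  show ?thesis
  proof (intro conjI[OF ex] allI impI conjI)
    fix LV qP :: real
    assume LV: "0 \<le> LV" "\<forall>w\<in>D. \<forall>z\<in>D. grid_norm L (V w - V z) \<le> LV * grid_norm L (w - z)"
      and qP: "qP = k * LV / 2" "qP < 1"
    then have G: "qP-lipschitz_on D G" using lip_G lip_iff by blast
    \<comment> \<open>Compactness of \<open>D\<close> supplies the completeness that Banach's
      theorem requires.\<close>
    show "\<exists>!m_mid. m_mid \<in> D \<and> G m_mid = m_mid"
      using Banach_fix[of D qP G] D compact_imp_complete G G_self qP(2)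
      by (auto simp: lipschitz_on_def)
    fix m_mid mhat p
    assume "m_mid \<in> D \<and> G m_mid = m_mid \<and> mhat 0 \<in> D \<and> (\<forall>p. mhat (Suc p) = G (mhat p))"
    then have "norm (mhat p - m_mid) \<le> qP ^ p / (1 - qP) * norm (mhat 1 - mhat 0)"
      using contraction_iteration_error[OF G qP(2) G_self, of m_mid mhat p]
      by (simp add: dist_norm)
    then have "s * norm (mhat p - m_mid) \<le> s * (qP ^ p / (1 - qP) * norm (mhat 1 - mhat 0))"
      using s by (intro mult_left_mono) auto
    then show "grid_norm L (mhat p - m_mid) \<le>
        qP ^ p / (1 - qP) * grid_norm L (mhat 1 - mhat 0)"
      by (simp add: norm_eq mult.left_commute)
  qed
qed

end
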